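(* Let $G$ be a group (with the discrete topology), $X$ a Hausdorff locally compact paracompact space and $\varphi: G\curvearrowright X$ a properly discontinuous action. If $x_0\in X$, then the map $\varphi_{x_0}:(G,\varepsilon_G)\to(X,\varepsilon_\varphi)$ given by $\varphi_{x_0}(g)=\varphi(g,x_0)$ is a coarse embedding. Moreover, if $\varphi$ is cocompact, then $\varphi_{x_0}$ is a coarse equivalence.
   Context: A coarse structure on a set $X$ is a set $\varepsilon$ of subsets of $X\times X$ containing the diagonal and closed under subsets, finite unions, inverses and compositions; the coarse structure generated by a family of subsets of $X\times X$ is the intersection of all coarse structures containing it. $B\subseteq X$ is bounded if $B\times B\in\varepsilon$. A map $f:(X,\varepsilon)\to(Y,\zeta)$ is bornologous if $f(e):=(f\times f)(e)\in\zeta$ for all $e\in\varepsilon$, proper if preimages of bounded sets are bounded, and coarse if both. Two maps $f,g:S\to X$ are close if $\{(f(s),g(s)):s\in S\}\in\varepsilon$. A coarse map $f:X\to Y$ is a coarse equivalence if there is a coarse map $g:Y\to X$ with $f\circ g$ close to $id_Y$ and $g\circ f$ close to $id_X$. For $A\subseteq X$ the subspace coarse structure is $\varepsilon|_A=\{e\in\varepsilon:e\subseteq A\times A\}$. A coarse map $f:(X,\varepsilon)\to(Y,\zeta)$ is a coarse embedding if it is a coarse equivalence between $X$ and $f(X)$ with the subspace coarse structure. An action by homeomorphisms $\varphi:G\curvearrowright X$ is properly discontinuous if $\{g\in G:\varphi(g,K)\cap K\neq\emptyset\}$ is finite for every compact $K\subseteq X$, and cocompact if $X/\varphi$ is compact.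 A subset is topologically bounded if its closure is compact. For $A\subseteq X$, $Sat(A)=\{(\varphi(g,x),\varphi(g,x')):g\in G,\ x,x'\in A\}$. $\varepsilon_\varphi$ is the coarse structure on $X$ generated by $\{Sat(A): A \text{ topologically bounded in } X\}$. $\varepsilon_G$ denotes $\varepsilon_\varphi$ in the case $X=G$ with $\varphi$ the left multiplication action. *)

theory Defs
  imports "HOL-Analysis.Analysis" "HOL-Algebra.Group_Action"
begin

section \<open>Coarse structures\<close>

text \<open>A coarse space is given by a carrier set \<open>X\<close> and a set \<open>\<epsilon>\<close> of subsets of \<open>X \<times> X\<close>.
  Maps between coarse spaces are total functions, of which only the values on the carrier matter.\<close>

definition coarse_structure :: "'a set \<Rightarrow> ('a \<times> 'a) set set \<Rightarrow> bool" where
  "coarse_structure X \<epsilon> \<longleftrightarrow>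
     (\<forall>e\<in>\<epsilon>. e \<subseteq> X \<times> X) \<and>
     Id_on X \<in> \<epsilon> \<and>
     (\<forall>e\<in>\<epsilon>. \<forall>d. d \<subseteq> e \<longrightarrow> d \<in> \<epsilon>) \<and>
     (\<forall>d\<in>\<epsilon>. \<forall>e\<in>\<epsilon>. d \<union> e \<in> \<epsilon>) \<and>
     (\<forall>e\<in>\<epsilon>. e\<inverse> \<in> \<epsilon>) \<and>
     (\<forall>d\<in>\<epsilon>. \<forall>e\<in>\<epsilon>. d O e \<in> \<epsilon>)"

text \<open>Only meaningful if all members of \<open>F\<close> are subsets of \<open>X \<times> X\<close>; otherwise the
  intersection is over the empty family.\<close>

definition generated_coarse_structure ::
    "'a set \<Rightarrow> ('a \<times> 'a) set set \<Rightarrow> ('a \<times> 'a) set set" where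
  "generated_coarse_structure X F = \<Inter>{\<epsilon>. coarse_structure X \<epsilon> \<and> F \<subseteq> \<epsilon>}"

lemma coarse_structure_Pow: "coarse_structure X (Pow (X \<times> X))"
  unfolding coarse_structure_def by auto

lemma coarse_structure_generated:
  assumes "F \<subseteq> Pow (X \<times> X)"
  shows "coarse_structure X (generated_coarse_structure X F)"
proof -
  define D where "D = generated_coarse_structure X F"
  have mem: "e \<in> D \<longleftrightarrow> (\<forall>\<epsilon>. coarse_structure X \<epsilon> \<longrightarrow> F \<subseteq> \<epsilon> \<longrightarrow> e \<in> \<epsilon>)" for e
    unfolding D_def generated_coarse_structure_def by blast
  have 1: "e \<subseteq> X \<times> X" if "e \<in> D" for e
    using that assms coarse_structure_Pow unfolding mem by blast
  have 2: "Id_on X \<in> D"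
    unfolding mem by (simp add: coarse_structure_def)
  have 3: "d \<in> D" if "e \<in> D" "d \<subseteq> e" for d e
    unfolding mem
  proof (intro allI impI)
    fix \<epsilon> assume *: "coarse_structure X \<epsilon>" "F \<subseteq> \<epsilon>"
    then have "e \<in> \<epsilon>" using that(1) by (simp add: mem)
    with * that(2) show "d \<in> \<epsilon>" by (simp add: coarse_structure_def)
  qed
  have 4: "d \<union> e \<in> D" "e\<inverse> \<in> D" "d O e \<in> D" if "d \<in> D" "e \<in> D" for d e
  proof -
    have "d \<union> e \<in> \<epsilon> \<and> e\<inverse> \<in> \<epsilon> \<and> d O e \<in> \<epsilon>"
      if *: "coarse_structure X \<epsilon>" "F \<subseteq> \<epsilon>" for \<epsilon>
    proof -
      have "d \<in> \<epsilon>" "e \<in> \<epsilon>" using * \<open>d \<in> D\<close> \<open>e \<in> D\<close> by (simp_all add: mem)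
      with * show ?thesis by (simp add: coarse_structure_def)
    qed
    then show "d \<union> e \<in> D" "e\<inverse> \<in> D" "d O e \<in> D" by (simp_all add: mem)
  qed
  have "coarse_structure X D"
    unfolding coarse_structure_def
    by (intro conjI ballI allI impI) (rule 1 2 4; assumption | rule 2 | erule (1) 3)+
  then show ?thesis by (simp add: D_def)
qed

definition coarsely_bounded :: "'a set \<Rightarrow> ('a \<times> 'a) set set \<Rightarrow> 'a set \<Rightarrow> bool" where
  "coarsely_bounded X \<epsilon> B \<longleftrightarrow> B \<subseteq> X \<and> B \<times> B \<in> \<epsilon>"

definition bornologous :: "('a \<times> 'a) set set \<Rightarrow> ('b \<times> 'b) set set \<Rightarrow> ('a \<Rightarrow> 'b) \<Rightarrow> bool" where
  "bornologous \<epsilon> \<zeta> f \<longleftrightarrow> (\<forall>e\<in>\<epsilon>. map_prod f f ` e \<in> \<zeta>)"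

definition coarsely_proper ::
    "'a set \<Rightarrow> ('a \<times> 'a) set set \<Rightarrow> 'b set \<Rightarrow> ('b \<times> 'b) set set \<Rightarrow> ('a \<Rightarrow> 'b) \<Rightarrow> bool" where
  "coarsely_proper X \<epsilon> Y \<zeta> f \<longleftrightarrow>
     (\<forall>B. coarsely_bounded Y \<zeta> B \<longrightarrow> coarsely_bounded X \<epsilon> {x \<in> X. f x \<in> B})"

definition coarse_map ::
    "'a set \<Rightarrow> ('a \<times> 'a) set set \<Rightarrow> 'b set \<Rightarrow> ('b \<times> 'b) set set \<Rightarrow> ('a \<Rightarrow> 'b) \<Rightarrow> bool" where
  "coarse_map X \<epsilon> Y \<zeta> f \<longleftrightarrow>
     f \<in> X \<rightarrow> Y \<and> bornologous \<epsilon> \<zeta> f \<and> coarsely_proper X \<epsilon> Y \<zeta> f"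

definition close_maps :: "'s set \<Rightarrow> ('a \<times> 'a) set set \<Rightarrow> ('s \<Rightarrow> 'a) \<Rightarrow> ('s \<Rightarrow> 'a) \<Rightarrow> bool" where
  "close_maps S \<epsilon> f g \<longleftrightarrow> {(f s, g s) | s. s \<in> S} \<in> \<epsilon>"

definition coarse_equivalence ::
    "'a set \<Rightarrow> ('a \<times> 'a) set set \<Rightarrow> 'b set \<Rightarrow> ('b \<times> 'b) set set \<Rightarrow> ('a \<Rightarrow> 'b) \<Rightarrow> bool" where
  "coarse_equivalence X \<epsilon> Y \<zeta> f \<longleftrightarrow>
     coarse_map X \<epsilon> Y \<zeta> f \<and>
     (\<exists>g. coarse_map Y \<zeta> X \<epsilon> g \<and> close_maps Y \<zeta> (f \<circ> g) id \<and> close_maps X \<epsilon> (g \<circ> f) id)"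

definition subspace_coarse_structure ::
    "('a \<times> 'a) set set \<Rightarrow> 'a set \<Rightarrow> ('a \<times> 'a) set set" where
  "subspace_coarse_structure \<epsilon> A = {e \<in> \<epsilon>. e \<subseteq> A \<times> A}"

definition coarse_embedding ::
    "'a set \<Rightarrow> ('a \<times> 'a) set set \<Rightarrow> 'b set \<Rightarrow> ('b \<times> 'b) set set \<Rightarrow> ('a \<Rightarrow> 'b) \<Rightarrow> bool" where
  "coarse_embedding X \<epsilon> Y \<zeta> f \<longleftrightarrow>
     coarse_map X \<epsilon> Y \<zeta> f \<and>
     coarse_equivalence X \<epsilon> (f ` X) (subspace_coarse_structure \<zeta> (f ` X)) f"

section \<open>Topological actions\<close>

definition paracompact_space :: "'a topology \<Rightarrow> bool" where
  "paracompact_space X \<longleftrightarrow>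
     (\<forall>\<U>. (\<forall>U\<in>\<U>. openin X U) \<and> \<Union>\<U> = topspace X \<longrightarrow>
        (\<exists>\<V>. (\<forall>V\<in>\<V>. openin X V) \<and> \<Union>\<V> = topspace X \<and>
             (\<forall>V\<in>\<V>. \<exists>U\<in>\<U>. V \<subseteq> U) \<and> locally_finite_in X \<V>))"

text \<open>In \<^const>\<open>group_action\<close>, each \<open>\<phi> g\<close> is a bijection of the carrier that is
  \<open>undefined\<close> off the carrier.\<close>

definition homeomorphism_action ::
    "('g, 'm) monoid_scheme \<Rightarrow> 'x topology \<Rightarrow> ('g \<Rightarrow> 'x \<Rightarrow> 'x) \<Rightarrow> bool" where
  "homeomorphism_action G X \<phi> \<longleftrightarrow>
     group_action G (topspace X) \<phi> \<and> (\<forall>g\<in>carrier G. homeomorphic_map X X (\<phi> g))"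

definition properly_discontinuous ::
    "('g, 'm) monoid_scheme \<Rightarrow> 'x topology \<Rightarrow> ('g \<Rightarrow> 'x \<Rightarrow> 'x) \<Rightarrow> bool" where
  "properly_discontinuous G X \<phi> \<longleftrightarrow>
     (\<forall>K. compactin X K \<longrightarrow> finite {g \<in> carrier G. \<phi> g ` K \<inter> K \<noteq> {}})"

definition orbit_space ::
    "('g, 'm) monoid_scheme \<Rightarrow> 'x topology \<Rightarrow> ('g \<Rightarrow> 'x \<Rightarrow> 'x) \<Rightarrow> 'x set topology" where
  "orbit_space G X \<phi> =
     topology (\<lambda>U. U \<subseteq> orbits G (topspace X) \<phi> \<and> openin X {x \<in> topspace X. orbit G \<phi> x \<in> U})"

lemma openin_orbit_space:
  "openin (orbit_space G X \<phi>) U \<longleftrightarrow>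
     U \<subseteq> orbits G (topspace X) \<phi> \<and> openin X {x \<in> topspace X. orbit G \<phi> x \<in> U}"
proof -
  let ?L = "\<lambda>U. U \<subseteq> orbits G (topspace X) \<phi> \<and> openin X {x \<in> topspace X. orbit G \<phi> x \<in> U}"
  have "?L (S \<inter> T)" if "?L S" "?L T" for S T
  proof -
    have "{x \<in> topspace X. orbit G \<phi> x \<in> S \<inter> T} =
        {x \<in> topspace X. orbit G \<phi> x \<in> S} \<inter> {x \<in> topspace X. orbit G \<phi> x \<in> T}" by auto
    then show ?thesis using that by (auto intro: openin_Int)
  qed
  moreover have "?L (\<Union>\<K>)" if "\<forall>K\<in>\<K>. ?L K" for \<K>
  proof -
    have "{x \<in> topspace X. orbit G \<phi> x \<in> \<Union>\<K>} =
        (\<Union>K\<in>\<K>. {x \<in> topspace X. orbit G \<phi> x \<in> K})" by auto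
    moreover have "openin X (\<Union>K\<in>\<K>. {x \<in> topspace X. orbit G \<phi> x \<in> K})"
      using that by (intro openin_Union) auto
    ultimately show ?thesis using that by auto
  qed
  ultimately have "istopology ?L"
    unfolding istopology_def by blast
  then show ?thesis
    by (simp add: orbit_space_def topology_inverse')
qed

lemma topspace_orbit_space: "topspace (orbit_space G X \<phi>) = orbits G (topspace X) \<phi>"
proof (rule antisym)
  show "topspace (orbit_space G X \<phi>) \<subseteq> orbits G (topspace X) \<phi>"
    using openin_topspace[of "orbit_space G X \<phi>"] unfolding openin_orbit_space by (rule conjunct1)
  have "{x \<in> topspace X. orbit G \<phi> x \<in> orbits G (topspace X) \<phi>} = topspace X"
    unfolding orbits_def by auto
  then show "orbits G (topspace X) \<phi> \<subseteq> topspace (orbit_space G X \<phi>)"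
    by (intro openin_subset) (simp add: openin_orbit_space)
qed

lemma quotient_map_orbit_space: "quotient_map X (orbit_space G X \<phi>) (orbit G \<phi>)"
  unfolding quotient_map_def topspace_orbit_space
  by (auto simp: openin_orbit_space orbits_def)

definition cocompact ::
    "('g, 'm) monoid_scheme \<Rightarrow> 'x topology \<Rightarrow> ('g \<Rightarrow> 'x \<Rightarrow> 'x) \<Rightarrow> bool" where
  "cocompact G X \<phi> \<longleftrightarrow> compact_space (orbit_space G X \<phi>)"

section \<open>The coarse structure of an action\<close>

definition topologically_bounded :: "'x topology \<Rightarrow> 'x set \<Rightarrow> bool" where
  "topologically_bounded X A \<longleftrightarrow> A \<subseteq> topspace X \<and> compactin X (X closure_of A)"

definition Sat ::
    "('g, 'm) monoid_scheme \<Rightarrow> ('g \<Rightarrow> 'x \<Rightarrow> 'x) \<Rightarrow> 'x set \<Rightarrow> ('x \<times> 'x) set" where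
  "Sat G \<phi> A = {(\<phi> g x, \<phi> g x') | g x x'. g \<in> carrier G \<and> x \<in> A \<and> x' \<in> A}"

definition action_coarse_structure ::
    "('g, 'm) monoid_scheme \<Rightarrow> 'x topology \<Rightarrow> ('g \<Rightarrow> 'x \<Rightarrow> 'x) \<Rightarrow> ('x \<times> 'x) set set" where
  "action_coarse_structure G X \<phi> =
     generated_coarse_structure (topspace X) {Sat G \<phi> A | A. topologically_bounded X A}"

definition left_mult_action :: "('g, 'm) monoid_scheme \<Rightarrow> 'g \<Rightarrow> 'g \<Rightarrow> 'g" where
  "left_mult_action G = (\<lambda>g. \<lambda>h\<in>carrier G. g \<otimes>\<^bsub>G\<^esub> h)"

definition group_coarse_structure :: "('g, 'm) monoid_scheme \<Rightarrow> ('g \<times> 'g) set set" where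
  "group_coarse_structure G =
     action_coarse_structure G (discrete_topology (carrier G)) (left_mult_action G)"

end

theory Submission
  imports Defs
begin

text \<open>For a properly discontinuous action on a Hausdorff space, an entourage of \<open>\<epsilon>\<^sub>\<phi>\<close> is precisely a
  relation contained in \<open>Sat K\<close> together with the diagonal, for a single compact \<open>K\<close>: if
  \<open>g k' = h l\<close> with \<open>k', l \<in> K\<close>, then \<open>h\<inverse> g\<close> lies in a finite set, so composing two saturations
  only enlarges \<open>K\<close> by finitely many translates. On the group itself this says that \<open>a\<inverse> b\<close> takes
  finitely many values. Hence the orbit map transports entourages in both directions, and any
  section up to bounded error is a coarse inverse: on the orbit an exact section exists, and in
  the cocompact case one finds it by covering the space with the translates of a compact set.\<close>

section \<open>Coarse equivalences from effectively proper maps\<close>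

lemma coarse_structureD:
  assumes "coarse_structure X \<epsilon>"
  shows "e \<in> \<epsilon> \<Longrightarrow> e \<subseteq> X \<times> X" "Id_on X \<in> \<epsilon>" "e \<in> \<epsilon> \<Longrightarrow> d \<subseteq> e \<Longrightarrow> d \<in> \<epsilon>"
    "d \<in> \<epsilon> \<Longrightarrow> e \<in> \<epsilon> \<Longrightarrow> d \<union> e \<in> \<epsilon>" "e \<in> \<epsilon> \<Longrightarrow> e\<inverse> \<in> \<epsilon>"
    "d \<in> \<epsilon> \<Longrightarrow> e \<in> \<epsilon> \<Longrightarrow> d O e \<in> \<epsilon>"
  using assms unfolding coarse_structure_def by blast+

lemma coarse_structure_subspace:
  assumes "coarse_structure X \<epsilon>" "A \<subseteq> X"
  shows "coarse_structure A (subspace_coarse_structure \<epsilon> A)"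
proof -
  note D = coarse_structureD[OF assms(1)]
  have "Id_on A \<subseteq> Id_on X"
    using assms(2) by blast
  then have "Id_on A \<in> \<epsilon>"
    using D(2,3) by blast
  then show ?thesis
    unfolding coarse_structure_def subspace_coarse_structure_def
    using D(3-6) by auto
qed

text \<open>Assumption \<open>eff\<close> (effective properness) implies ordinary properness: for
  bounded \<open>B\<close>, the square of the preimage of \<open>B\<close> is contained in the
  pullback of the entourage \<open>B \<times> B\<close>.\<close>

lemma coarse_mapI:
  assumes X: "coarse_structure X \<epsilon>" and f: "f \<in> X \<rightarrow> Y" and born: "bornologous \<epsilon> \<zeta> f"
    and eff: "\<And>d. d \<in> \<zeta> \<Longrightarrow> {(x, x'). x \<in> X \<and> x' \<in> X \<and> (f x, f x') \<in> d} \<in> \<epsilon>"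
  shows "coarse_map X \<epsilon> Y \<zeta> f"
proof -
  have "coarsely_proper X \<epsilon> Y \<zeta> f"
    unfolding coarsely_proper_def coarsely_bounded_def
  proof (intro allI impI conjI)
    fix B assume "B \<subseteq> Y \<and> B \<times> B \<in> \<zeta>"
    then show "{x \<in> X. f x \<in> B} \<times> {x \<in> X. f x \<in> B} \<in> \<epsilon>"
      by (intro coarse_structureD(3)[OF X eff[of "B \<times> B"]]) auto
  qed auto
  with f born show ?thesis
    by (simp add: coarse_map_def)
qed

text \<open>A section \<open>r\<close> up to bounded error is automatically a coarse inverse. Its
  error relation \<open>R\<close> is an entourage, so statements about \<open>r\<close> become
  statements about \<open>f \<circ> r\<close> by composing with \<open>R\<close> on both sides, and
  \<open>eff\<close> carries them back to \<open>X\<close>.\<close>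

lemma coarse_equivalenceI:
  assumes X: "coarse_structure X \<epsilon>" and Y: "coarse_structure Y \<zeta>"
    and f: "f \<in> X \<rightarrow> Y" and born: "bornologous \<epsilon> \<zeta> f"
    and eff: "\<And>d. d \<in> \<zeta> \<Longrightarrow> {(x, x'). x \<in> X \<and> x' \<in> X \<and> (f x, f x') \<in> d} \<in> \<epsilon>"
    and r: "r \<in> Y \<rightarrow> X" and close: "close_maps Y \<zeta> (f \<circ> r) id"
  shows "coarse_equivalence X \<epsilon> Y \<zeta> f"
proof -
  note DX = coarse_structureD[OF X] and DY = coarse_structureD[OF Y]
  define R where "R = {(f (r y), y) | y. y \<in> Y}"
  have R: "R \<in> \<zeta>"
    using close by (simp add: close_maps_def R_def)
  have "map_prod r r ` d \<in> \<epsilon>" if d: "d \<in> \<zeta>" for d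
  proof -
    \<comment> \<open>For \<open>(y, y') \<in> d\<close>, the route from \<open>f (r y)\<close> to
      \<open>y\<close>, then \<open>y'\<close>, then \<open>f (r y')\<close> lies in this composite;
      its pullback along \<open>f\<close> therefore contains \<open>(r y, r y')\<close>.\<close>
    have "R O d O R\<inverse> \<in> \<zeta>"
      using R d DY(5,6) by blast
    moreover have "map_prod r r ` d \<subseteq> {(x, x'). x \<in> X \<and> x' \<in> X \<and> (f x, f x') \<in> R O d O R\<inverse>}"
      using r DY(1)[OF d] unfolding R_def by fastforce
    ultimately show ?thesis
      using DX(3)[OF eff] by blast
  qed
  then have born_r: "bornologous \<zeta> \<epsilon> r"
    by (simp add: bornologous_def)
  have "{(y, y'). y \<in> Y \<and> y' \<in> Y \<and> (r y, r y') \<in> e} \<in> \<zeta>" if "e \<in> \<epsilon>" for e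
  proof -
    have "map_prod f f ` e \<in> \<zeta>"
      using born that by (simp add: bornologous_def)
    then have "R\<inverse> O map_prod f f ` e O R \<in> \<zeta>"
      using R DY(5,6) by blast
    moreover have "{(y, y'). y \<in> Y \<and> y' \<in> Y \<and> (r y, r y') \<in> e} \<subseteq> R\<inverse> O map_prod f f ` e O R"
    proof clarify
      fix y y' assume "y \<in> Y" "y' \<in> Y" "(r y, r y') \<in> e"
      then have "(y, f (r y)) \<in> R\<inverse>" "(f (r y), f (r y')) \<in> map_prod f f ` e" "(f (r y'), y') \<in> R"
        by (auto simp: R_def)
      then show "(y, y') \<in> R\<inverse> O map_prod f f ` e O R"
        by (intro relcompI)
    qed
    ultimately show ?thesis
      using DY(3) by blast
  qed
  then have "coarse_map Y \<zeta> X \<epsilon> r"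
    using Y r born_r by (intro coarse_mapI) auto
  moreover have "close_maps X \<epsilon> (r \<circ> f) id"
  proof -
    \<comment> \<open>Applying \<open>f\<close> to the pair \<open>(r (f x), x)\<close> gives the
      error pair of \<open>r\<close> at the point \<open>f x\<close>, so the other closeness
      condition follows by pulling back \<open>R\<close>.\<close>
    have "{((r \<circ> f) x, id x) | x. x \<in> X} \<subseteq> {(x, x'). x \<in> X \<and> x' \<in> X \<and> (f x, f x') \<in> R}"
      using f r by (auto simp: R_def)
    then show ?thesis
      unfolding close_maps_def using DX(3)[OF eff[OF R]] by blast
  qed
  ultimately show ?thesis
    unfolding coarse_equivalence_def using coarse_mapI[OF X f born eff] close by blast
qed

section \<open>Entourages of a properly discontinuous action\<close>

locale properly_discontinuous_action = group_action G "topspace X" \<phi>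
  for G (structure) and X :: "'x topology" and \<phi> +
  assumes Hausdorff: "Hausdorff_space X"
    and homeomorphic: "g \<in> carrier G \<Longrightarrow> homeomorphic_map X X (\<phi> g)"
    and finite_return: "compactin X K \<Longrightarrow> finite {g \<in> carrier G. \<phi> g ` K \<inter> K \<noteq> {}}"
begin

sublocale group G
  using group_hom group_hom.axioms(1) by blast

lemma compactin_action:
  "g \<in> carrier G \<Longrightarrow> compactin X K \<Longrightarrow> compactin X (\<phi> g ` K)"
  using homeomorphic homeomorphic_imp_continuous_map image_compactin by blast

lemma action_in: "g \<in> carrier G \<Longrightarrow> x \<in> topspace X \<Longrightarrow> \<phi> g x \<in> topspace X"
  using element_image by blast

text \<open>Whenever translates of two points of a compact set coincide, this exhibits the relative
  group element as a member of the finite return set of that compact set.\<close>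

lemma action_inv_mult:
  assumes "g \<in> carrier G" "h \<in> carrier G" "x \<in> topspace X" "y \<in> topspace X" "\<phi> g x = \<phi> h y"
  shows "\<phi> (inv h \<otimes> g) x = y"
  using assms by (metis composition_rule inv_closed orbit_sym_aux)

section \<open>Saturations and their composition\<close>

lemma Sat_subset: "A \<subseteq> topspace X \<Longrightarrow> Sat G \<phi> A \<subseteq> topspace X \<times> topspace X"
  using action_in by (auto simp: Sat_def)

lemma Sat_mono: "A \<subseteq> B \<Longrightarrow> Sat G \<phi> A \<subseteq> Sat G \<phi> B"
  by (auto simp: Sat_def)

lemma Sat_converse: "(Sat G \<phi> A)\<inverse> = Sat G \<phi> A"
  by (auto simp: Sat_def)

text \<open>Composition is the coarse axiom that uses proper discontinuity: only finitely many
  translates of \<open>K\<close> meet \<open>K\<close>, and adjoining them to \<open>K\<close> keeps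
  it compact.\<close>

lemma Sat_relcomp:
  assumes K: "compactin X K"
  obtains L where "compactin X L" "Sat G \<phi> K O Sat G \<phi> K \<subseteq> Sat G \<phi> L"
proof
  define F where "F = {g \<in> carrier G. \<phi> g ` K \<inter> K \<noteq> {}}"
  define L where "L = K \<union> (\<Union>g\<in>F. \<phi> g ` K)"
  have KX: "K \<subseteq> topspace X"
    using K compactin_subset_topspace by blast
  have "finite F"
    unfolding F_def by (rule finite_return[OF K])
  then show "compactin X L"
    unfolding L_def using K
    by (intro compactin_Un compactin_Union) (auto simp: F_def intro: compactin_action)
  show "Sat G \<phi> K O Sat G \<phi> K \<subseteq> Sat G \<phi> L"
  proof
    fix p assume "p \<in> Sat G \<phi> K O Sat G \<phi> K"
    then obtain g h a b c d where p: "p = (\<phi> g a, \<phi> h d)" and gh: "g \<in> carrier G" "h \<in> carrier G"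
      and abcd: "a \<in> K" "b \<in> K" "c \<in> K" "d \<in> K" and eq: "\<phi> g b = \<phi> h c"
      unfolding Sat_def by auto
    \<comment> \<open>The composed pair must be written as a translate by a single element. Since
      \<open>f\<close> moves \<open>b\<close> to \<open>c\<close> inside \<open>K\<close>, it lies
      in \<open>F\<close>, and \<open>g = h \<otimes> f\<close> turns the pair into the
      \<open>h\<close>-translate of \<open>(\<phi> f a, d)\<close>.\<close>
    define f where "f = inv h \<otimes> g"
    have f: "f \<in> carrier G" "h \<otimes> f = g"
      using gh by (auto simp: f_def simp flip: m_assoc)
    have "\<phi> f b = c"
      unfolding f_def using gh abcd eq KX by (intro action_inv_mult) auto
    then have "f \<in> F"
      using f abcd by (auto simp: F_def)
    then have "\<phi> f a \<in> L" "d \<in> L"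
      using abcd by (auto simp: L_def)
    moreover have "\<phi> g a = \<phi> h (\<phi> f a)"
      using f gh abcd KX composition_rule[of a h f] by auto
    ultimately show "p \<in> Sat G \<phi> L"
      using p gh unfolding Sat_def by blast
  qed
qed

text \<open>Closed form of the generated structure. \<open>Id\<close> is adjoined because the
  diagonal lies in some \<open>Sat G \<phi> K\<close> only when translates of a compact set cover
  the space. As \<open>Id\<close> ranges over the whole type, containment in the carrier square is
  required separately.\<close>

definition compactly_controlled :: "('x \<times> 'x) set set" where
  "compactly_controlled =
     {e. e \<subseteq> topspace X \<times> topspace X \<and> (\<exists>K. compactin X K \<and> e \<subseteq> Sat G \<phi> K \<union> Id)}"

lemma compactly_controlledI:
  assumes "e \<subseteq> topspace X \<times> topspace X" "compactin X K" "e \<subseteq> Sat G \<phi> K \<union> Id"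
  shows "e \<in> compactly_controlled"
  using assms unfolding compactly_controlled_def by blast

lemma compactly_controlledE:
  assumes "e \<in> compactly_controlled"
  obtains K where "e \<subseteq> topspace X \<times> topspace X" "compactin X K" "e \<subseteq> Sat G \<phi> K \<union> Id"
  using assms unfolding compactly_controlled_def by blast

lemma coarse_structure_compactly_controlled:
  "coarse_structure (topspace X) compactly_controlled"
proof -
  have common: "\<exists>K. compactin X K \<and> d \<subseteq> Sat G \<phi> K \<union> Id \<and> e \<subseteq> Sat G \<phi> K \<union> Id"
    if "d \<in> compactly_controlled" "e \<in> compactly_controlled" for d e
  proof -
    obtain K L where KL: "compactin X K" "d \<subseteq> Sat G \<phi> K \<union> Id" "compactin X L" "e \<subseteq> Sat G \<phi> L \<union> Id"
      using \<open>d \<in> _\<close> \<open>e \<in> _\<close> by (meson compactly_controlledE)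
    moreover have "Sat G \<phi> K \<subseteq> Sat G \<phi> (K \<union> L)" "Sat G \<phi> L \<subseteq> Sat G \<phi> (K \<union> L)"
      by (auto intro!: Sat_mono)
    moreover have "compactin X (K \<union> L)"
      using KL by (simp add: compactin_Un)
    ultimately show ?thesis
      by blast
  qed
  have sub: "e \<subseteq> topspace X \<times> topspace X" if "e \<in> compactly_controlled" for e
    using that by (rule compactly_controlledE)
  have Id: "Id_on (topspace X) \<in> compactly_controlled"
    by (rule compactly_controlledI[where K = "{}"]) auto
  have down: "d \<in> compactly_controlled" if "e \<in> compactly_controlled" "d \<subseteq> e" for d e
  proof -
    obtain K where "e \<subseteq> topspace X \<times> topspace X" "compactin X K" "e \<subseteq> Sat G \<phi> K \<union> Id"
      using \<open>e \<in> _\<close> by (rule compactly_controlledE)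
    then show ?thesis
      by (intro compactly_controlledI[of d K] subset_trans[OF \<open>d \<subseteq> e\<close>])
  qed
  have Un: "d \<union> e \<in> compactly_controlled"
    if "d \<in> compactly_controlled" "e \<in> compactly_controlled" for d e
  proof -
    obtain K where "compactin X K" "d \<union> e \<subseteq> Sat G \<phi> K \<union> Id"
      using common[OF \<open>d \<in> _\<close> \<open>e \<in> _\<close>] by auto
    moreover have "d \<union> e \<subseteq> topspace X \<times> topspace X"
      using that[THEN sub] by (rule Un_least)
    ultimately show ?thesis
      by (metis compactly_controlledI)
  qed
  have conv: "e\<inverse> \<in> compactly_controlled" if "e \<in> compactly_controlled" for e
  proof -
    obtain K where K: "compactin X K" "e \<subseteq> Sat G \<phi> K \<union> Id"
      using \<open>e \<in> _\<close> by (rule compactly_controlledE)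
    then have "e\<inverse> \<subseteq> (Sat G \<phi> K)\<inverse> \<union> Id"
      by blast
    moreover have "e\<inverse> \<subseteq> topspace X \<times> topspace X"
      using sub[OF that] by blast
    ultimately show ?thesis
      using K(1) by (metis Sat_converse compactly_controlledI)
  qed
  have comp: "d O e \<in> compactly_controlled"
    if "d \<in> compactly_controlled" "e \<in> compactly_controlled" for d e
  proof -
    obtain K where K: "compactin X K" "d \<subseteq> Sat G \<phi> K \<union> Id" "e \<subseteq> Sat G \<phi> K \<union> Id"
      using common[OF \<open>d \<in> _\<close> \<open>e \<in> _\<close>] by (elim exE conjE)
    obtain L where L: "compactin X L" "Sat G \<phi> K O Sat G \<phi> K \<subseteq> Sat G \<phi> L"
      by (rule Sat_relcomp[OF K(1)])
    \<comment> \<open>Expanding the product of the two bounds yields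
      \<open>Sat G \<phi> K O Sat G \<phi> K\<close>, controlled by \<open>L\<close>, and cross
      terms with \<open>Id\<close>, controlled by \<open>K\<close>; the union handles both.\<close>
    have "Sat G \<phi> K \<subseteq> Sat G \<phi> (K \<union> L)" "Sat G \<phi> L \<subseteq> Sat G \<phi> (K \<union> L)"
      by (auto intro!: Sat_mono)
    then have "(Sat G \<phi> K \<union> Id) O (Sat G \<phi> K \<union> Id) \<subseteq> Sat G \<phi> (K \<union> L) \<union> Id"
      using L(2) by auto
    then have "d O e \<subseteq> Sat G \<phi> (K \<union> L) \<union> Id"
      using relcomp_mono[OF K(2,3)] by (rule subset_trans[rotated])
    moreover have "compactin X (K \<union> L)"
      using K L by (simp add: compactin_Un)
    moreover have "d O e \<subseteq> topspace X \<times> topspace X"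
      using that[THEN sub] by blast
    ultimately show ?thesis
      by (metis compactly_controlledI)
  qed
  show ?thesis
    unfolding coarse_structure_def
    by (intro conjI ballI allI impI)
      (rule sub Un conv comp; assumption | rule Id | erule (1) down)+
qed

section \<open>Identification of the generated structure with compact control\<close>

lemma Sat_bounded_subset: "{Sat G \<phi> A | A. topologically_bounded X A} \<subseteq> Pow (topspace X \<times> topspace X)"
  using Sat_subset by (auto simp: topologically_bounded_def)

lemma coarse_structure_action:
  "coarse_structure (topspace X) (action_coarse_structure G X \<phi>)"
  unfolding action_coarse_structure_def
  by (rule coarse_structure_generated[OF Sat_bounded_subset])

text \<open>One inclusion is minimality of the generated structure, each bounded set being replaced
  by its compact closure. For the other, compact sets are closed in a Hausdorff space, so their
  saturations are themselves generators.\<close>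

lemma action_coarse_structure_eq: "action_coarse_structure G X \<phi> = compactly_controlled"
proof
  have "Sat G \<phi> A \<in> compactly_controlled" if "topologically_bounded X A" for A
  proof -
    have "A \<subseteq> X closure_of A"
      using that by (simp add: topologically_bounded_def closure_of_subset)
    then have "Sat G \<phi> A \<subseteq> Sat G \<phi> (X closure_of A)"
      by (rule Sat_mono)
    with that show ?thesis
      using Sat_subset[of A] unfolding compactly_controlled_def topologically_bounded_def by blast
  qed
  then show "action_coarse_structure G X \<phi> \<subseteq> compactly_controlled"
    using coarse_structure_compactly_controlled
    unfolding action_coarse_structure_def generated_coarse_structure_def by blast
next
  note D = coarse_structureD[OF coarse_structure_action]
  show "compactly_controlled \<subseteq> action_coarse_structure G X \<phi>"
  proof
    fix e assume "e \<in> compactly_controlled"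
    then obtain K where e: "e \<subseteq> topspace X \<times> topspace X" and K: "compactin X K"
      and eK: "e \<subseteq> Sat G \<phi> K \<union> Id"
      by (auto simp: compactly_controlled_def)
    have "topologically_bounded X K"
      using K Hausdorff compactin_imp_closedin[OF Hausdorff K]
      by (simp add: topologically_bounded_def closure_of_closedin compactin_subset_topspace)
    then have "Sat G \<phi> K \<in> action_coarse_structure G X \<phi>"
      unfolding action_coarse_structure_def generated_coarse_structure_def by blast
    then have "Sat G \<phi> K \<union> Id_on (topspace X) \<in> action_coarse_structure G X \<phi>"
      using D(2,4) by blast
    moreover have "e \<subseteq> Sat G \<phi> K \<union> Id_on (topspace X)"
      using e eK by blast
    ultimately show "e \<in> action_coarse_structure G X \<phi>"
      by (rule D(3))
  qed
qed

lemma action_coarse_structureI: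
  assumes "compactin X K" "e \<subseteq> Sat G \<phi> K"
  shows "e \<in> action_coarse_structure G X \<phi>"
proof -
  have "e \<subseteq> topspace X \<times> topspace X"
    using assms Sat_subset compactin_subset_topspace by (meson subset_trans)
  moreover have "e \<subseteq> Sat G \<phi> K \<union> Id"
    using assms(2) by (rule le_supI1)
  ultimately show ?thesis
    unfolding action_coarse_structure_eq using assms(1) by (metis compactly_controlledI)
qed

end

section \<open>The coarse structure of the group\<close>

lemma (in group) left_mult_action_group_action: "group_action G (carrier G) (left_mult_action G)"
proof -
  have bij: "left_mult_action G g \<in> Bij (carrier G)" if "g \<in> carrier G" for g
  proof -
    have "bij_betw (\<lambda>h. g \<otimes> h) (carrier G) (carrier G)"
      using that by (intro bij_betwI[where g = "\<lambda>h. inv g \<otimes> h"]) (auto simp flip: m_assoc)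
    then show ?thesis
      by (simp add: Bij_def left_mult_action_def)
  qed
  have "left_mult_action G (g \<otimes> h) = compose (carrier G) (left_mult_action G g) (left_mult_action G h)"
    if "g \<in> carrier G" "h \<in> carrier G" for g h
    using that by (auto simp: left_mult_action_def compose_def fun_eq_iff m_assoc)
  with bij have "left_mult_action G \<in> hom G (BijGroup (carrier G))"
    by (auto simp: hom_def BijGroup_def)
  then show ?thesis
    by (simp add: group_action_def group_hom_def group_hom_axioms_def group_BijGroup is_group)
qed

text \<open>Compact sets of a discrete space are finite, and an element moving
  \<open>k \<in> K\<close> into \<open>K\<close> is a quotient \<open>b \<otimes> inv a\<close> of
  two members of \<open>K\<close>.\<close>

lemma (in group) properly_discontinuous_left_mult:
  "properly_discontinuous_action G (discrete_topology (carrier G)) (left_mult_action G)"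
proof -
  interpret L: group_action G "carrier G" "left_mult_action G"
    by (rule left_mult_action_group_action)
  show ?thesis
  proof (intro properly_discontinuous_action.intro properly_discontinuous_action_axioms.intro)
    fix K assume "compactin (discrete_topology (carrier G)) K"
    then have K: "finite K" "K \<subseteq> carrier G"
      by (auto simp: compactin_discrete_topology)
    have "{g \<in> carrier G. left_mult_action G g ` K \<inter> K \<noteq> {}} \<subseteq> (\<lambda>(a, b). b \<otimes> inv a) ` (K \<times> K)"
    proof
      fix g assume "g \<in> {g \<in> carrier G. left_mult_action G g ` K \<inter> K \<noteq> {}}"
      then obtain k where g: "g \<in> carrier G" "k \<in> K" "left_mult_action G g k \<in> K"
        by blast
      then have k: "k \<in> carrier G"
        using K by blast
      with g have "left_mult_action G g k = g \<otimes> k" "g = (g \<otimes> k) \<otimes> inv k"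
        by (auto simp: left_mult_action_def m_assoc)
      with g show "g \<in> (\<lambda>(a, b). b \<otimes> inv a) ` (K \<times> K)"
        by (intro image_eqI[of _ _ "(k, g \<otimes> k)"]) auto
    qed
    then show "finite {g \<in> carrier G. left_mult_action G g ` K \<inter> K \<noteq> {}}"
      by (rule finite_subset) (use K in auto)
  next
    fix g assume "g \<in> carrier G"
    from L.surj_prop[OF this] L.inj_prop[OF this]
    show "homeomorphic_map (discrete_topology (carrier G)) (discrete_topology (carrier G))
        (left_mult_action G g)"
      by (intro bijective_open_imp_homeomorphic_map) (auto simp: open_map_def)
  qed (use left_mult_action_group_action in auto)
qed

lemma (in group) coarse_structure_group:
  "coarse_structure (carrier G) (group_coarse_structure G)"
  using properly_discontinuous_action.coarse_structure_action[OF properly_discontinuous_left_mult]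
  by (simp add: group_coarse_structure_def)

text \<open>The quotient \<open>inv a \<otimes> b\<close> is a complete invariant of a pair under
  simultaneous left multiplication, so saturating a finite set amounts to allowing finitely many
  quotients.\<close>

lemma (in group) group_coarse_structure_iff:
  "e \<in> group_coarse_structure G \<longleftrightarrow>
     e \<subseteq> carrier G \<times> carrier G \<and> finite ((\<lambda>(a, b). inv a \<otimes> b) ` e)"
proof -
  interpret L: properly_discontinuous_action G "discrete_topology (carrier G)" "left_mult_action G"
    by (rule properly_discontinuous_left_mult)
  let ?D = "\<lambda>(a, b). inv a \<otimes> b"
  show ?thesis
    unfolding group_coarse_structure_def
  proof (intro iffI conjI)
    assume "e \<in> action_coarse_structure G (discrete_topology (carrier G)) (left_mult_action G)"
    then obtain K where e: "e \<subseteq> carrier G \<times> carrier G" and K: "finite K" "K \<subseteq> carrier G"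
      and eK: "e \<subseteq> Sat G (left_mult_action G) K \<union> Id"
      by (auto simp: L.action_coarse_structure_eq L.compactly_controlled_def
          compactin_discrete_topology)
    show "e \<subseteq> carrier G \<times> carrier G"
      by (rule e)
    \<comment> \<open>The extra \<open>\<one>\<close> is the quotient of the diagonal pairs coming
      from \<open>Id\<close>.\<close>
    have "?D ` e \<subseteq> insert \<one> (?D ` (K \<times> K))"
    proof clarify
      fix a b assume ab: "(a, b) \<in> e" "inv a \<otimes> b \<notin> ?D ` (K \<times> K)"
      show "inv a \<otimes> b = \<one>"
      proof (cases "a = b")
        case True
        with ab e show ?thesis by auto
      next
        case False
        with ab eK obtain g k l where g: "g \<in> carrier G" "k \<in> K" "l \<in> K"
          "a = left_mult_action G g k" "b = left_mult_action G g l"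
          unfolding Sat_def by blast
        then have kl: "k \<in> carrier G" "l \<in> carrier G"
          using K by auto
        then have "a = g \<otimes> k" "b = g \<otimes> l"
          using g by (auto simp: left_mult_action_def)
        then have "inv a \<otimes> b = inv k \<otimes> (inv g \<otimes> (g \<otimes> l))"
          using g kl by (simp add: inv_mult_group m_assoc)
        also have "inv g \<otimes> (g \<otimes> l) = l"
          using g kl by (simp flip: m_assoc)
        finally have "inv a \<otimes> b \<in> ?D ` (K \<times> K)"
          using g by auto
        with ab show ?thesis by blast
      qed
    qed
    then show "finite (?D ` e)"
      by (rule finite_subset) (use K in auto)
  next
    assume e: "e \<subseteq> carrier G \<times> carrier G \<and> finite (?D ` e)"
    show "e \<in> action_coarse_structure G (discrete_topology (carrier G)) (left_mult_action G)"
    proof (rule L.action_coarse_structureI)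
      \<comment> \<open>This finite set works because \<open>(a, b)\<close> is the
        \<open>a\<close>-translate of \<open>(\<one>, inv a \<otimes> b)\<close>.\<close>
      show "compactin (discrete_topology (carrier G)) (insert \<one> (?D ` e))"
        using e by (auto simp: compactin_discrete_topology)
      show "e \<subseteq> Sat G (left_mult_action G) (insert \<one> (?D ` e))"
      proof clarify
        fix a b assume ab: "(a, b) \<in> e"
        then have "a \<in> carrier G" "b \<in> carrier G"
          using e by auto
        then have "a = left_mult_action G a \<one>" "b = left_mult_action G a (inv a \<otimes> b)"
          by (auto simp: left_mult_action_def simp flip: m_assoc)
        moreover have "inv a \<otimes> b \<in> ?D ` e"
          using ab by force
        ultimately show "(a, b) \<in> Sat G (left_mult_action G) (insert \<one> (?D ` e))"
          unfolding Sat_def using \<open>a \<in> carrier G\<close> by blast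
      qed
    qed
  qed
qed

section \<open>Orbit maps\<close>

context properly_discontinuous_action
begin

lemma orbit_map_bornologous:
  assumes x: "x \<in> topspace X"
  shows "bornologous (group_coarse_structure G) (action_coarse_structure G X \<phi>) (\<lambda>g. \<phi> g x)"
  unfolding bornologous_def
proof
  fix e assume "e \<in> group_coarse_structure G"
  then have e: "e \<subseteq> carrier G \<times> carrier G" and fin: "finite ((\<lambda>(a, b). inv a \<otimes> b) ` e)"
    by (auto simp: group_coarse_structure_iff)
  \<comment> \<open>The pair of orbit points at \<open>a\<close> and \<open>b\<close> is the
    \<open>a\<close>-translate of \<open>x\<close> and its image under
    \<open>inv a \<otimes> b\<close>; finitely many quotients occur, so \<open>K\<close> is
    finite.\<close>
  define K where "K = insert x ((\<lambda>f. \<phi> f x) ` (\<lambda>(a, b). inv a \<otimes> b) ` e)"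
  have "K \<subseteq> topspace X"
    using e x by (auto simp: K_def intro!: action_in)
  moreover have "finite K"
    using fin by (simp add: K_def)
  ultimately have "compactin X K"
    by (simp add: finite_imp_compactin)
  moreover have "map_prod (\<lambda>g. \<phi> g x) (\<lambda>g. \<phi> g x) ` e \<subseteq> Sat G \<phi> K"
  proof clarsimp
    fix a b assume ab: "(a, b) \<in> e"
    then have G: "a \<in> carrier G" "b \<in> carrier G"
      using e by auto
    have "\<phi> a (\<phi> (inv a \<otimes> b) x) = \<phi> (a \<otimes> (inv a \<otimes> b)) x"
      using G x by (simp add: composition_rule)
    also have "a \<otimes> (inv a \<otimes> b) = b"
      using G by (simp flip: m_assoc)
    finally have "\<phi> b x = \<phi> a (\<phi> (inv a \<otimes> b) x)" ..
    moreover have "\<phi> (inv a \<otimes> b) x \<in> K" "x \<in> K"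
      using ab by (force simp: K_def)+
    ultimately show "(\<phi> a x, \<phi> b x) \<in> Sat G \<phi> K"
      unfolding Sat_def using G by blast
  qed
  ultimately show "map_prod (\<lambda>g. \<phi> g x) (\<lambda>g. \<phi> g x) ` e \<in> action_coarse_structure G X \<phi>"
    by (rule action_coarse_structureI)
qed

text \<open>Orbit points controlled by \<open>K\<close> are moved into \<open>K\<close> by a common
  \<open>inv h\<close>. Both \<open>inv h \<otimes> a\<close> and \<open>inv h \<otimes> b\<close>
  then lie in the finite return set, and so \<open>inv a \<otimes> b\<close> takes finitely many
  values.\<close>

lemma orbit_map_effectively_proper:
  assumes x: "x \<in> topspace X" and d: "d \<in> action_coarse_structure G X \<phi>"
  shows "{(a, b). a \<in> carrier G \<and> b \<in> carrier G \<and> (\<phi> a x, \<phi> b x) \<in> d} \<in> group_coarse_structure G"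
    (is "?e \<in> _")
proof -
  obtain K0 where K0: "compactin X K0" "d \<subseteq> Sat G \<phi> K0 \<union> Id"
    using d by (auto simp: action_coarse_structure_eq compactly_controlled_def)
  \<comment> \<open>Adjoining \<open>x\<close> serves twice: pairs with equal orbit points, possibly
    from different group elements, fall under \<open>Sat G \<phi> K\<close> without
    \<open>Id\<close>, and an element moving \<open>x\<close> into \<open>K\<close> becomes a return
    element.\<close>
  define K where "K = insert x K0"
  have K: "compactin X K"
    using K0 x compactin_Un[of X "{x}" K0] by (simp add: K_def)
  then have KX: "K \<subseteq> topspace X"
    by (rule compactin_subset_topspace)
  define F where "F = {g \<in> carrier G. \<phi> g ` K \<inter> K \<noteq> {}}"
  have F: "finite F"
    unfolding F_def by (rule finite_return[OF K])
  have "(\<lambda>(a, b). inv a \<otimes> b) ` ?e \<subseteq> (\<lambda>(f, f'). inv f \<otimes> f') ` (F \<times> F)"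
  proof clarify
    fix a b assume ab: "a \<in> carrier G" "b \<in> carrier G" "(\<phi> a x, \<phi> b x) \<in> d"
    have "(\<phi> a x, \<phi> b x) \<in> Sat G \<phi> K"
    proof (cases "\<phi> a x = \<phi> b x")
      case True
      with ab show ?thesis
        unfolding Sat_def K_def by auto
    next
      case False
      with ab K0(2) have "(\<phi> a x, \<phi> b x) \<in> Sat G \<phi> K0"
        by blast
      then show ?thesis
        using Sat_mono[of K0 K] by (auto simp: K_def)
    qed
    then obtain h k l where h: "h \<in> carrier G" "k \<in> K" "l \<in> K" "\<phi> a x = \<phi> h k" "\<phi> b x = \<phi> h l"
      unfolding Sat_def by blast
    have "\<phi> (inv h \<otimes> a) x = k" "\<phi> (inv h \<otimes> b) x = l"
      using h ab x KX by (auto intro!: action_inv_mult)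
    then have "inv h \<otimes> a \<in> F" "inv h \<otimes> b \<in> F"
      using h ab by (auto simp: F_def K_def)
    moreover have "inv a \<otimes> b = inv (inv h \<otimes> a) \<otimes> (inv h \<otimes> b)"
    proof -
      have "inv (inv h \<otimes> a) \<otimes> (inv h \<otimes> b) = inv a \<otimes> (h \<otimes> (inv h \<otimes> b))"
        using h ab by (simp add: inv_mult_group m_assoc)
      also have "h \<otimes> (inv h \<otimes> b) = b"
        using h ab by (simp flip: m_assoc)
      finally show ?thesis ..
    qed
    ultimately show "inv a \<otimes> b \<in> (\<lambda>(f, f'). inv f \<otimes> f') ` (F \<times> F)"
      by auto
  qed
  then have "finite ((\<lambda>(a, b). inv a \<otimes> b) ` ?e)"
    by (rule finite_subset) (use F in auto)
  then show ?thesis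
    unfolding group_coarse_structure_iff by auto
qed

lemma orbit_map_coarse_embedding:
  assumes x: "x \<in> topspace X"
  shows "coarse_embedding (carrier G) (group_coarse_structure G)
    (topspace X) (action_coarse_structure G X \<phi>) (\<lambda>g. \<phi> g x)"
proof -
  define Y where "Y = (\<lambda>g. \<phi> g x) ` carrier G"
  \<comment> \<open>The orbit map may have nontrivial stabilizers, so \<open>r\<close> merely
    chooses a preimage. On the orbit it is an exact section, whose error relation is contained in
    the diagonal.\<close>
  define r where "r = inv_into (carrier G) (\<lambda>g. \<phi> g x)"
  have r: "r y \<in> carrier G" "\<phi> (r y) x = y" if "y \<in> Y" for y
    using that unfolding Y_def r_def
    by (rule inv_into_into, rule f_inv_into_f[where f = "\<lambda>g. \<phi> g x"])
  have Y: "Y \<subseteq> topspace X"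
    using x by (auto simp: Y_def intro: action_in)
  note DY = coarse_structure_subspace[OF coarse_structure_action Y]
  have "coarse_map (carrier G) (group_coarse_structure G)
      (topspace X) (action_coarse_structure G X \<phi>) (\<lambda>g. \<phi> g x)"
    using x by (intro coarse_mapI coarse_structure_group orbit_map_bornologous
        orbit_map_effectively_proper) (auto intro: action_in)
  moreover have "coarse_equivalence (carrier G) (group_coarse_structure G)
      Y (subspace_coarse_structure (action_coarse_structure G X \<phi>) Y) (\<lambda>g. \<phi> g x)"
  proof (rule coarse_equivalenceI[where r = r, OF coarse_structure_group DY])
    show "bornologous (group_coarse_structure G)
        (subspace_coarse_structure (action_coarse_structure G X \<phi>) Y) (\<lambda>g. \<phi> g x)"
      using orbit_map_bornologous[OF x] coarse_structureD(1)[OF coarse_structure_group]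
      unfolding bornologous_def subspace_coarse_structure_def Y_def by fastforce
    have "{(((\<lambda>g. \<phi> g x) \<circ> r) y, id y) | y. y \<in> Y} \<subseteq> Id_on Y"
      using r by auto
    then show "close_maps Y (subspace_coarse_structure (action_coarse_structure G X \<phi>) Y)
        ((\<lambda>g. \<phi> g x) \<circ> r) id"
      unfolding close_maps_def by (rule coarse_structureD(3)[OF DY coarse_structureD(2)[OF DY]])
  qed (use x r in \<open>auto simp: Y_def subspace_coarse_structure_def
      intro: orbit_map_effectively_proper\<close>)
  ultimately show ?thesis
    by (simp add: coarse_embedding_def Y_def)
qed

section \<open>Cocompact actions: from the orbit space to a compact set with covering
  translates\<close>

lemma openin_orbit_image:
  assumes U: "openin X U"
  shows "openin (orbit_space G X \<phi>) (orbit G \<phi> ` U)"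
proof -
  have UX: "U \<subseteq> topspace X"
    using U by (rule openin_subset)
  \<comment> \<open>The orbit projection is open because the preimage of the image of
    \<open>U\<close> is the union of its translates, each open as the image of \<open>U\<close>
    under a homeomorphism.\<close>
  have "{y \<in> topspace X. orbit G \<phi> y \<in> orbit G \<phi> ` U} = (\<Union>g\<in>carrier G. \<phi> g ` U)"
  proof (intro equalityI subsetI)
    fix y assume "y \<in> {y \<in> topspace X. orbit G \<phi> y \<in> orbit G \<phi> ` U}"
    then obtain u where u: "y \<in> topspace X" "u \<in> U" "orbit G \<phi> y = orbit G \<phi> u"
      by auto
    then have "y \<in> orbit G \<phi> u"
      using orbit_refl by blast
    with u(2) show "y \<in> (\<Union>g\<in>carrier G. \<phi> g ` U)"
      by (auto simp: orbit_def)
  next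
    fix y assume "y \<in> (\<Union>g\<in>carrier G. \<phi> g ` U)"
    then obtain g u where u: "g \<in> carrier G" "u \<in> U" "y = \<phi> g u"
      by auto
    then have y: "y \<in> topspace X" "u \<in> topspace X" "y \<in> orbit G \<phi> u"
      using UX by (auto intro: action_in simp: orbit_def)
    then have "y \<in> orbit G \<phi> y"
      using orbit_refl by blast
    \<comment> \<open>Distinct orbits are disjoint, and both of these contain
      \<open>y\<close>.\<close>
    then have "orbit G \<phi> y = orbit G \<phi> u"
      using disjoint_union[of "orbit G \<phi> y" "orbit G \<phi> u"] y by (auto simp: orbits_def)
    with y u show "y \<in> {y \<in> topspace X. orbit G \<phi> y \<in> orbit G \<phi> ` U}"
      by blast
  qed
  moreover have "openin X (\<Union>g\<in>carrier G. \<phi> g ` U)"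
    using U homeomorphic homeomorphic_imp_open_map by (fastforce simp: open_map_def)
  ultimately show ?thesis
    using UX by (auto simp: openin_orbit_space orbits_def)
qed

text \<open>Local compactness covers the space by open sets lying in compact sets. Their images are
  open in the compact orbit space, so finitely many suffice, and the union of the corresponding
  compact sets meets every orbit.\<close>

lemma cocompact_compact_cover:
  assumes loc: "locally_compact_space X" and "cocompact G X \<phi>"
  obtains K where "compactin X K" "topspace X = (\<Union>g\<in>carrier G. \<phi> g ` K)"
proof -
  define \<U> where "\<U> = {U. openin X U \<and> (\<exists>K. compactin X K \<and> U \<subseteq> K)}"
  have "compactin (orbit_space G X \<phi>) (orbits G (topspace X) \<phi>)"
    using \<open>cocompact G X \<phi>\<close> by (simp add: cocompact_def compact_space_def topspace_orbit_space)
  moreover have "\<And>V. V \<in> (\<lambda>U. orbit G \<phi> ` U) ` \<U> \<Longrightarrow> openin (orbit_space G X \<phi>) V"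
    using openin_orbit_image by (auto simp: \<U>_def)
  moreover have "orbits G (topspace X) \<phi> \<subseteq> \<Union> ((\<lambda>U. orbit G \<phi> ` U) ` \<U>)"
    using loc unfolding locally_compact_space_def orbits_def \<U>_def by blast
  ultimately obtain \<F> where \<F>: "finite \<F>" "\<F> \<subseteq> (\<lambda>U. orbit G \<phi> ` U) ` \<U>"
    "orbits G (topspace X) \<phi> \<subseteq> \<Union>\<F>"
    using compactinD by metis
  then obtain \<V> where \<V>: "\<V> \<subseteq> \<U>" "finite \<V>" "\<F> = (\<lambda>U. orbit G \<phi> ` U) ` \<V>"
    using finite_subset_image by metis
  have "\<exists>C. compactin X C \<and> U \<subseteq> C" if "U \<in> \<V>" for U
    using that \<V>(1) by (auto simp: \<U>_def)
  then obtain C where C: "compactin X (C U)" "U \<subseteq> C U" if "U \<in> \<V>" for U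
    by metis
  define K where "K = (\<Union>U\<in>\<V>. C U)"
  have K: "compactin X K"
    unfolding K_def using \<V>(2) C by (intro compactin_Union) auto
  moreover have "topspace X = (\<Union>g\<in>carrier G. \<phi> g ` K)"
  proof (intro equalityI subsetI)
    fix y assume y: "y \<in> topspace X"
    then have "orbit G \<phi> y \<in> \<Union>\<F>"
      using \<F>(3) by (auto simp: orbits_def)
    then obtain U u where u: "U \<in> \<V>" "u \<in> U" "orbit G \<phi> y = orbit G \<phi> u"
      using \<V>(3) by auto
    then have "u \<in> K"
      using C(2) by (auto simp: K_def)
    moreover have "y \<in> orbit G \<phi> u"
      using u(3) orbit_refl[OF y] by blast
    ultimately show "y \<in> (\<Union>g\<in>carrier G. \<phi> g ` K)"
      by (auto simp: orbit_def)
  next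
    fix y assume "y \<in> (\<Union>g\<in>carrier G. \<phi> g ` K)"
    then show "y \<in> topspace X"
      using compactin_subset_topspace[OF K] by (auto intro: action_in)
  qed
  ultimately show thesis
    by (rule that)
qed

lemma orbit_map_coarse_equivalence:
  assumes x: "x \<in> topspace X" and "locally_compact_space X" "cocompact G X \<phi>"
  shows "coarse_equivalence (carrier G) (group_coarse_structure G)
    (topspace X) (action_coarse_structure G X \<phi>) (\<lambda>g. \<phi> g x)"
proof -
  obtain K where K: "compactin X K" and cover: "topspace X = (\<Union>g\<in>carrier G. \<phi> g ` K)"
    using cocompact_compact_cover assms by blast
  have "\<exists>g. g \<in> carrier G \<and> y \<in> \<phi> g ` K" if "y \<in> topspace X" for y
    using that unfolding cover by blast
  \<comment> \<open>The approximate section picks a translate of \<open>K\<close> containing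
    \<open>y\<close>. Then \<open>y\<close> and \<open>\<phi> (r y) x\<close> lie in the same
    translate of \<open>insert x K\<close>, so a single saturation bounds the error.\<close>
  then obtain r where r: "r y \<in> carrier G" "y \<in> \<phi> (r y) ` K" if "y \<in> topspace X" for y
    by metis
  have "compactin X (insert x K)"
    using K x compactin_Un[of X "{x}" K] by simp
  moreover have "{(((\<lambda>g. \<phi> g x) \<circ> r) y, id y) | y. y \<in> topspace X} \<subseteq> Sat G \<phi> (insert x K)"
  proof clarsimp
    fix y assume y: "y \<in> topspace X"
    then obtain k where "k \<in> K" "y = \<phi> (r y) k"
      using r(2) by blast
    then show "(\<phi> (r y) x, y) \<in> Sat G \<phi> (insert x K)"
      unfolding Sat_def using r(1)[OF y] by blast
  qed
  ultimately have "close_maps (topspace X) (action_coarse_structure G X \<phi>) ((\<lambda>g. \<phi> g x) \<circ> r) id"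
    unfolding close_maps_def by (rule action_coarse_structureI)
  with x r(1) show ?thesis
    by (intro coarse_equivalenceI[where r = r] coarse_structure_group coarse_structure_action
        orbit_map_bornologous orbit_map_effectively_proper) (auto intro: action_in)
qed

end

theorem proposition2p5:
  fixes G :: "('g, 'm) monoid_scheme"
    and X :: "'x topology"
    and \<phi> :: "'g \<Rightarrow> 'x \<Rightarrow> 'x"
    and x\<^sub>0 :: 'x
  assumes "group G"
    and "Hausdorff_space X" and "locally_compact_space X" and "paracompact_space X"
    and "homeomorphism_action G X \<phi>" and "properly_discontinuous G X \<phi>"
    and "x\<^sub>0 \<in> topspace X"
  shows "coarse_embedding (carrier G) (group_coarse_structure G)
           (topspace X) (action_coarse_structure G X \<phi>) (\<lambda>g. \<phi> g x\<^sub>0) \<and>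
         (cocompact G X \<phi> \<longrightarrow>
           coarse_equivalence (carrier G) (group_coarse_structure G)
             (topspace X) (action_coarse_structure G X \<phi>) (\<lambda>g. \<phi> g x\<^sub>0))"
proof -
  interpret properly_discontinuous_action G X \<phi>
    using assms(2,5,6)
    by (simp add: properly_discontinuous_action_def properly_discontinuous_action_axioms_def
        homeomorphism_action_def properly_discontinuous_def)
  show ?thesis
    using orbit_map_coarse_embedding orbit_map_coarse_equivalence assms(3,7) by blast
qed

end
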